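(* Let $G$ be a torsion-free abelian group, let $R=\bigoplus_{k\in G}R_k$ be a $G$-graded commutative ring, and let $f=\sum_{k\in G}r_k\in R$ with $r_k\in R_k$ for all $k$ (and $r_k=0$ for all but finitely many $k$). Then $f$ is invertible in $R$ if and only if the ideal $(r_k: k\in G)$ generated by the homogeneous components of $f$ equals $R$ and $r_ir_k$ is nilpotent for all $i\neq k$ in $G$.
   Context: Rings have an identity. A $G$-graded ring is a ring $R$ with a decomposition $R=\bigoplus_{n\in G}R_n$ of its additive group into subgroups with $R_mR_n\subseteq R_{m+n}$ for all $m,n\in G$. *)

theory Defs
  imports "HOL-Algebra.Algebra"
begin

text \<open>The library writes groups multiplicatively, so the sum \<open>m + n\<close> of two degrees appears below
  as \<open>m \<otimes>\<^bsub>G\<^esub> n\<close>.\<close>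

definition torsion_free :: "('g, 'a) monoid_scheme \<Rightarrow> bool" where
  "torsion_free G \<longleftrightarrow>
     (\<forall>x\<in>carrier G. \<forall>n::nat. n > 0 \<longrightarrow> x [^]\<^bsub>G\<^esub> n = \<one>\<^bsub>G\<^esub> \<longrightarrow> x = \<one>\<^bsub>G\<^esub>)"

definition nilpotent :: "('r, 'b) ring_scheme \<Rightarrow> 'r \<Rightarrow> bool" where
  "nilpotent R x \<longleftrightarrow> x \<in> carrier R \<and> (\<exists>n::nat. x [^]\<^bsub>R\<^esub> n = \<zero>\<^bsub>R\<^esub>)"

definition deg_support ::
  "('g, 'a) monoid_scheme \<Rightarrow> ('r, 'b) ring_scheme \<Rightarrow> ('g \<Rightarrow> 'r) \<Rightarrow> 'g set" where
  "deg_support G R c = {k \<in> carrier G. c k \<noteq> \<zero>\<^bsub>R\<^esub>}"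

text \<open>The sum of a finitely supported family runs over its support only, because \<open>finsum\<close> over an
  infinite set is \<open>\<zero>\<close> by convention, even if almost all summands vanish.\<close>

definition deg_sum ::
  "('g, 'a) monoid_scheme \<Rightarrow> ('r, 'b) ring_scheme \<Rightarrow> ('g \<Rightarrow> 'r) \<Rightarrow> 'r" where
  "deg_sum G R c = finsum R c (deg_support G R c)"

text \<open>In \<open>direct_sum\<close>, the families are extensional (\<open>\<Pi>\<^sub>E\<close>) so that their values outside
  \<open>carrier G\<close> do not spoil uniqueness.\<close>

locale graded_ring = ring R + G: comm_group G
  for R :: "('r, 'b) ring_scheme" (structure)
    and G :: "('g, 'a) monoid_scheme"
    and \<A> :: "'g \<Rightarrow> 'r set" +
  assumes component_subgroup: "k \<in> carrier G \<Longrightarrow> additive_subgroup (\<A> k) R"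
    and component_mult:
      "\<lbrakk>m \<in> carrier G; n \<in> carrier G; x \<in> \<A> m; y \<in> \<A> n\<rbrakk> \<Longrightarrow> x \<otimes> y \<in> \<A> (m \<otimes>\<^bsub>G\<^esub> n)"
    and direct_sum:
      "x \<in> carrier R \<Longrightarrow>
         \<exists>!c. c \<in> (\<Pi>\<^sub>E k\<in>carrier G. \<A> k) \<and> finite (deg_support G R c) \<and> x = deg_sum G R c"

end

theory Submission
  imports Defs
begin

text \<open>
  The theorem reduces to prime ideals, since a non-nilpotent element avoids some prime and a proper
  ideal lies in some prime. If \<open>f\<close> is a unit with inverse \<open>g\<close> of components \<open>s\<^sub>j\<close>, and \<open>Q\<close> is a
  prime, consider the degrees \<open>A = {i. r\<^sub>i \<notin> Q}\<close> and \<open>B = {j. s\<^sub>j \<notin> Q}\<close>. A torsion-free abelian group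
  can be totally ordered, and the component of \<open>f g = \<one>\<close> in degree \<open>min A + min B\<close> is congruent
  modulo \<open>Q\<close> to a product of two elements outside of \<open>Q\<close>. As \<open>\<one>\<close> is homogeneous of degree \<open>0\<close>, it
  follows that \<open>min A + min B = 0\<close>; likewise \<open>max A + max B = 0\<close>, so that \<open>A\<close> is a singleton.
  Conversely, if \<open>f\<close> lies in a prime \<open>Q\<close> and at most one \<open>r\<^sub>k\<close> lies outside of \<open>Q\<close>, then all \<open>r\<^sub>k\<close>
  lie in \<open>Q\<close>, so that they do not generate the unit ideal.
\<close>

section \<open>Orderability of torsion-free abelian groups\<close>

text \<open>A total order \<open>\<le>\<close> on an abelian group that is invariant under translation is encoded by
  its set of nonnegative elements: \<open>x \<le> y\<close> means \<open>y \<otimes> inv x \<in> P\<close>.\<close>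

definition pointed_cone :: "('g, 'a) monoid_scheme \<Rightarrow> 'g set \<Rightarrow> bool" where
  "pointed_cone G P \<longleftrightarrow> P \<subseteq> carrier G \<and> \<one>\<^bsub>G\<^esub> \<in> P \<and> (\<forall>x\<in>P. \<forall>y\<in>P. x \<otimes>\<^bsub>G\<^esub> y \<in> P) \<and>
     (\<forall>x\<in>P. inv\<^bsub>G\<^esub> x \<in> P \<longrightarrow> x = \<one>\<^bsub>G\<^esub>)"

definition total_cone :: "('g, 'a) monoid_scheme \<Rightarrow> 'g set \<Rightarrow> bool" where
  "total_cone G P \<longleftrightarrow> pointed_cone G P \<and> (\<forall>x\<in>carrier G. x \<in> P \<or> inv\<^bsub>G\<^esub> x \<in> P)"

context comm_group
begin

lemma pointed_cone_pow:
  assumes "pointed_cone G P" "x \<in> P"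
  shows "x [^] (n::nat) \<in> P"
proof -
  have "\<one> \<in> P" "\<And>y. y \<in> P \<Longrightarrow> y \<otimes> x \<in> P"
    using assms unfolding pointed_cone_def by blast+
  then show ?thesis by (induction n) simp_all
qed

text \<open>Otherwise \<open>P\<close> and \<open>x\<close> generate a strictly larger pointed cone.\<close>

lemma maximal_pointed_cone_inv_pow:
  assumes P: "pointed_cone G P"
    and max: "\<And>P'. pointed_cone G P' \<Longrightarrow> P \<subseteq> P' \<Longrightarrow> P' = P"
    and x: "x \<in> carrier G" "x \<notin> P"
  shows "\<exists>n::nat. n > 0 \<and> inv (x [^] n) \<in> P"
proof -
  have sub: "P \<subseteq> carrier G" and one: "\<one> \<in> P"
    and mult: "\<And>a b. a \<in> P \<Longrightarrow> b \<in> P \<Longrightarrow> a \<otimes> b \<in> P"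
    and pointed: "\<And>a. a \<in> P \<Longrightarrow> inv a \<in> P \<Longrightarrow> a = \<one>"
    using P by (auto simp: pointed_cone_def)
  \<comment> \<open>The submonoid generated by \<open>P\<close> and \<open>x\<close>: exponent 0
    recovers \<open>P\<close>, and exponent 1 with \<open>\<one>\<close> gives
    \<open>x\<close>.\<close>
  define P' where "P' = {p \<otimes> x [^] n | p n. p \<in> P \<and> n \<in> (UNIV :: nat set)}"
  have P'I: "p \<otimes> x [^] n \<in> P'" if "p \<in> P" for p and n :: nat
    using that by (auto simp: P'_def)
  have mult': "(p \<otimes> x [^] m) \<otimes> (q \<otimes> x [^] n) = (p \<otimes> q) \<otimes> x [^] (m + n)"
    if "p \<in> P" "q \<in> P" for p q and m n :: nat
    using that sub x(1) by (simp add: nat_pow_mult [symmetric] m_ac subset_iff)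
  have "P \<subseteq> P'"
  proof
    fix p assume "p \<in> P"
    then show "p \<in> P'" using P'I [of p 0] sub by auto
  qed
  moreover have "x \<in> P'" using P'I [OF one, of 1] x(1) by simp
  ultimately have "\<not> pointed_cone G P'" using max x(2) by blast
  moreover have "P' \<subseteq> carrier G" using sub x(1) by (auto simp: P'_def)
  moreover have "\<one> \<in> P'" using \<open>P \<subseteq> P'\<close> one by blast
  moreover have "a \<otimes> b \<in> P'" if ab: "a \<in> P'" "b \<in> P'" for a b
  proof -
    obtain p q and m n :: nat where "p \<in> P" "q \<in> P" "a = p \<otimes> x [^] m" "b = q \<otimes> x [^] n"
      using ab unfolding P'_def by blast
    then show ?thesis using mult' P'I mult by metis
  qed
  \<comment> \<open>Being a submonoid that properly contains \<open>P\<close>, \<open>P'\<close> can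
    only fail to be pointed.\<close>
  ultimately obtain y where y: "y \<in> P'" "inv y \<in> P'" "y \<noteq> \<one>"
    unfolding pointed_cone_def by blast
  obtain p q and m n :: nat where pq: "p \<in> P" "q \<in> P"
    and eq: "y = p \<otimes> x [^] m" "inv y = q \<otimes> x [^] n"
    using y unfolding P'_def by blast
  have yc: "y \<in> carrier G" using eq pq sub x(1) by auto
  have "(p \<otimes> q) \<otimes> x [^] (m + n) = \<one>"
    using mult' [OF pq] eq yc r_inv by metis
  then have "inv (x [^] (m + n)) = p \<otimes> q"
    using pq sub x(1) by (intro inv_equality) auto
  \<comment> \<open>With both exponents zero, \<open>y\<close> and its inverse would lie in
    \<open>P\<close>, against pointedness of \<open>P\<close>.\<close>
  moreover have "m + n > 0"
  proof (rule ccontr)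
    assume "\<not> m + n > 0"
    then have "y = p" "inv y = q" using eq pq sub by auto
    then show False using pointed pq y(3) by blast
  qed
  ultimately show ?thesis using mult pq by metis
qed

text \<open>Zorn's lemma gives a maximal pointed cone. If it contained neither \<open>x\<close> nor
  \<open>inv x\<close>, it would contain positive powers of both, hence a positive power of
  \<open>x\<close> together with its inverse. Pointedness makes that power trivial, and
  torsion-freeness then makes \<open>x\<close> trivial.\<close>

lemma exists_total_cone:
  assumes "torsion_free G"
  shows "\<exists>P. total_cone G P"
proof -
  have "\<exists>P\<in>Collect (pointed_cone G). \<forall>P'\<in>Collect (pointed_cone G). P \<subseteq> P' \<longrightarrow> P' = P"
  proof (rule subset_Zorn_nonempty)
    have "pointed_cone G {\<one>}" by (simp add: pointed_cone_def)
    then show "Collect (pointed_cone G) \<noteq> {}" by blast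
  next
    fix C assume C: "C \<noteq> {}" "subset.chain (Collect (pointed_cone G)) C"
    have cone: "pointed_cone G P" if "P \<in> C" for P
      using that C(2) by (auto simp: pred_on.chain_def)
    \<comment> \<open>In a chain, any two elements of the union share a member, so closure under
      products and pointedness pass to the union.\<close>
    have common: "\<exists>P\<in>C. x \<in> P \<and> y \<in> P" if "x \<in> \<Union>C" "y \<in> \<Union>C" for x y
      using that C(2) unfolding pred_on.chain_def by blast
    have "x \<otimes> y \<in> \<Union>C" if "x \<in> \<Union>C" "y \<in> \<Union>C" for x y
      using common [OF that] cone unfolding pointed_cone_def by blast
    moreover have "x = \<one>" if "x \<in> \<Union>C" "inv x \<in> \<Union>C" for x
      using common [OF that] cone unfolding pointed_cone_def by blast
    moreover have "\<Union>C \<subseteq> carrier G" "\<one> \<in> \<Union>C"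
      using C(1) cone unfolding pointed_cone_def by blast+
    ultimately have "pointed_cone G (\<Union>C)"
      unfolding pointed_cone_def by blast
    then show "\<Union>C \<in> Collect (pointed_cone G)" by simp
  qed
  then obtain P where P: "pointed_cone G P"
    and max: "\<And>P'. pointed_cone G P' \<Longrightarrow> P \<subseteq> P' \<Longrightarrow> P' = P"
    by auto
  have "x \<in> P \<or> inv x \<in> P" if x: "x \<in> carrier G" for x
  proof (rule ccontr)
    assume "\<not> ?thesis"
    then have nin: "x \<notin> P" "inv x \<notin> P" by auto
    obtain m :: nat where m: "m > 0" "inv (x [^] m) \<in> P"
      using maximal_pointed_cone_inv_pow [OF P max x nin(1)] by blast
    obtain n :: nat where n: "n > 0" "inv (inv x [^] n) \<in> P"
      using maximal_pointed_cone_inv_pow [OF P max inv_closed [OF x] nin(2)] by blast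
    have "x [^] n \<in> P" using n(2) x by (simp add: nat_pow_inv [symmetric])
    \<comment> \<open>The exponent \<open>n * m\<close> is common to the powers of
      \<open>x [^] n\<close> and of \<open>inv (x [^] m)\<close>, both of which stay in
      \<open>P\<close>.\<close>
    then have "x [^] (n * m) \<in> P"
      using pointed_cone_pow [OF P, of "x [^] n" m] x by (simp add: nat_pow_pow)
    moreover have "inv (x [^] (n * m)) \<in> P"
      using pointed_cone_pow [OF P m(2), of n] x
      by (simp add: nat_pow_inv nat_pow_pow mult.commute)
    ultimately have "x [^] (n * m) = \<one>"
      using P unfolding pointed_cone_def by blast
    then have "x = \<one>"
      using assms x m(1) n(1) unfolding torsion_free_def by (meson mult_pos_pos)
    then show False using nin(1) P by (simp add: pointed_cone_def)
  qed
  then show ?thesis using P unfolding total_cone_def by blast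
qed

text \<open>This is the reversed order; it turns statements about minima into statements about
  maxima.\<close>

lemma total_cone_opposite:
  assumes "total_cone G P"
  shows "total_cone G {x \<in> carrier G. inv x \<in> P}"
proof -
  have P: "\<one> \<in> P" "\<And>x y. x \<in> P \<Longrightarrow> y \<in> P \<Longrightarrow> x \<otimes> y \<in> P"
    "\<And>x. x \<in> P \<Longrightarrow> inv x \<in> P \<Longrightarrow> x = \<one>" "\<And>x. x \<in> carrier G \<Longrightarrow> x \<in> P \<or> inv x \<in> P"
    using assms by (auto simp: total_cone_def pointed_cone_def)
  have "inv (x \<otimes> y) \<in> P" if "x \<in> carrier G" "y \<in> carrier G" "inv x \<in> P" "inv y \<in> P" for x y
    using P(2) [OF that(3,4)] that by (simp add: inv_mult)
  moreover have "x = \<one>" if "x \<in> carrier G" "inv x \<in> P" "inv (inv x) \<in> P" for x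
    using P(3) [OF that(2,3)] that(1) by simp
  moreover have "inv x \<in> P \<or> inv (inv x) \<in> P" if "x \<in> carrier G" for x
    using P(4) that by blast
  ultimately show ?thesis
    unfolding total_cone_def pointed_cone_def using P(1) by simp
qed

lemma total_cone_minimum:
  assumes P: "total_cone G P" and "finite A" "A \<noteq> {}" "A \<subseteq> carrier G"
  shows "\<exists>a\<in>A. \<forall>x\<in>A. x \<otimes> inv a \<in> P"
  using assms(2-)
proof (induction A rule: finite_ne_induct)
  case (singleton x)
  then show ?case using P by (simp add: total_cone_def pointed_cone_def)
next
  case (insert x F)
  then obtain m where m: "m \<in> F" "\<And>y. y \<in> F \<Longrightarrow> y \<otimes> inv m \<in> P" by auto
  have c: "x \<in> carrier G" "m \<in> carrier G" "F \<subseteq> carrier G" using insert.prems m(1) by auto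
  have one: "\<one> \<in> P" and mult: "\<And>x y. x \<in> P \<Longrightarrow> y \<in> P \<Longrightarrow> x \<otimes> y \<in> P"
    using P by (auto simp: total_cone_def pointed_cone_def)
  have "x \<otimes> inv m \<in> P \<or> inv (x \<otimes> inv m) \<in> P"
    using P c by (simp add: total_cone_def)
  then show ?case
  proof
    assume "x \<otimes> inv m \<in> P"
    then show ?thesis using m by blast
  next
    assume "inv (x \<otimes> inv m) \<in> P"
    then have le: "m \<otimes> inv x \<in> P" using c by (simp add: inv_mult m_comm)
    have "y \<otimes> inv x \<in> P" if "y \<in> F" for y
    proof -
      have y: "y \<in> carrier G" using that c by auto
      \<comment> \<open>Transitivity of the order: the differences from \<open>x\<close> to
        \<open>m\<close> and from \<open>m\<close> to \<open>y\<close> multiply to the one from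
        \<open>x\<close> to \<open>y\<close>.\<close>
      have "(y \<otimes> inv m) \<otimes> (m \<otimes> inv x) = y \<otimes> ((inv m \<otimes> m) \<otimes> inv x)"
        using c y by (simp only: m_assoc m_closed inv_closed)
      then have "(y \<otimes> inv m) \<otimes> (m \<otimes> inv x) = y \<otimes> inv x"
        using c y by simp
      then show ?thesis using mult [OF m(2) [OF that] le] by simp
    qed
    then show ?thesis using one c by auto
  qed
qed

text \<open>The two nonnegative differences have product \<open>\<one>\<close>, so they are mutually
  inverse elements of \<open>P\<close>, and pointedness makes both trivial.\<close>

lemma total_cone_unique_product:
  assumes P: "total_cone G P"
    and c: "a \<in> carrier G" "b \<in> carrier G" "x \<in> carrier G" "y \<in> carrier G"
    and le: "x \<otimes> inv a \<in> P" "y \<otimes> inv b \<in> P"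
    and eq: "x \<otimes> y = a \<otimes> b"
  shows "x = a \<and> y = b"
proof -
  have "(x \<otimes> inv a) \<otimes> (y \<otimes> inv b) = (x \<otimes> y) \<otimes> inv (a \<otimes> b)"
    using c by (simp add: inv_mult m_ac)
  also have "\<dots> = \<one>" using c eq by simp
  finally have prod: "(x \<otimes> inv a) \<otimes> (y \<otimes> inv b) = \<one>" .
  then have "inv (y \<otimes> inv b) = x \<otimes> inv a"
    using c by (intro inv_equality) auto
  then have one: "y \<otimes> inv b = \<one>"
    using P le unfolding total_cone_def pointed_cone_def by metis
  then have "x \<otimes> inv a = \<one>" using prod c by simp
  with one show ?thesis
    using c inv_equality [of x "inv a"] inv_equality [of y "inv b"] by simp
qed

end

section \<open>Prime ideals avoiding a multiplicative set\<close>

text \<open>An ideal that is maximal among those containing \<open>I\<close> and disjoint from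
  \<open>S\<close> is prime: for \<open>a\<close> and \<open>b\<close> outside of it, the enlarged
  ideals both meet \<open>S\<close>, and so does their product.\<close>

lemma (in cring) exists_primeideal_avoiding:
  assumes I: "ideal I R" and disj: "I \<inter> S = {}"
    and S: "S \<subseteq> carrier R" "\<one> \<in> S" "\<And>x y. x \<in> S \<Longrightarrow> y \<in> S \<Longrightarrow> x \<otimes> y \<in> S"
  shows "\<exists>Q. primeideal Q R \<and> I \<subseteq> Q \<and> Q \<inter> S = {}"
proof -
  define F where "F = {J. ideal J R \<and> I \<subseteq> J \<and> J \<inter> S = {}}"
  have "\<exists>Q\<in>F. \<forall>J\<in>F. Q \<subseteq> J \<longrightarrow> J = Q"
  proof (rule subset_Zorn_nonempty)
    show "F \<noteq> {}" using I disj by (auto simp: F_def)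
  next
    fix C assume C: "C \<noteq> {}" "subset.chain F C"
    then have "subset.chain {J. ideal J R} C"
      by (auto simp: pred_on.chain_def F_def)
    from chain_Union_is_ideal [OF this] have "ideal (\<Union>C) R" using C(1) by simp
    moreover have "I \<subseteq> \<Union>C" "\<Union>C \<inter> S = {}"
      using C unfolding pred_on.chain_def F_def by blast+
    ultimately show "\<Union>C \<in> F" by (simp add: F_def)
  qed
  then obtain Q where Q: "Q \<in> F" and max: "\<And>J. J \<in> F \<Longrightarrow> Q \<subseteq> J \<Longrightarrow> J = Q" by blast
  from Q have QI: "ideal Q R" "I \<subseteq> Q" "Q \<inter> S = {}" by (auto simp: F_def)
  interpret Q: ideal Q R by (fact QI(1))
  \<comment> \<open>By maximality, adjoining \<open>a\<close> to \<open>Q\<close> must produce an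
    element of \<open>S\<close>.\<close>
  have meets: "\<exists>q\<in>Q. \<exists>x\<in>carrier R. q \<oplus> x \<otimes> a \<in> S" if a: "a \<in> carrier R" "a \<notin> Q" for a
  proof -
    have J: "ideal (Q <+> PIdl a) R"
      using add_ideals QI(1) cgenideal_ideal a(1) by blast
    have mem: "q \<oplus> x \<otimes> a \<in> Q <+> PIdl a" if "q \<in> Q" "x \<in> carrier R" for q x
      using that by (auto simp: set_add_def' cgenideal_def)
    have "Q \<subseteq> Q <+> PIdl a"
      using mem [of _ \<zero>] a(1) Q.Icarr by force
    moreover have "a \<in> Q <+> PIdl a"
      using mem [of \<zero> \<one>] a(1) by simp
    ultimately have "(Q <+> PIdl a) \<notin> F" using max a(2) by blast
    then have "(Q <+> PIdl a) \<inter> S \<noteq> {}"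
      using J \<open>Q \<subseteq> Q <+> PIdl a\<close> QI(2) by (auto simp: F_def)
    then show ?thesis by (auto simp: set_add_def' cgenideal_def)
  qed
  have "primeideal Q R"
  proof (rule primeidealI [OF QI(1) is_cring])
    show "carrier R \<noteq> Q" using S(2) QI(3) by auto
  next
    fix a b assume ab: "a \<in> carrier R" "b \<in> carrier R" "a \<otimes> b \<in> Q"
    show "a \<in> Q \<or> b \<in> Q"
    proof (rule ccontr)
      assume "\<not> ?thesis"
      then obtain p x q y where p: "p \<in> Q" "x \<in> carrier R" "p \<oplus> x \<otimes> a \<in> S"
        and q: "q \<in> Q" "y \<in> carrier R" "q \<oplus> y \<otimes> b \<in> S"
        using meets [OF ab(1)] meets [OF ab(2)] by blast
      have c: "p \<in> carrier R" "q \<in> carrier R" using p q Q.Icarr by auto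
      \<comment> \<open>After expansion, every summand has a factor \<open>p\<close>,
        \<open>q\<close> or \<open>a \<otimes> b\<close>, all of which lie in
        \<open>Q\<close>.\<close>
      have "(p \<oplus> x \<otimes> a) \<otimes> (q \<oplus> y \<otimes> b) =
          p \<otimes> (q \<oplus> y \<otimes> b) \<oplus> ((x \<otimes> a) \<otimes> q \<oplus> (x \<otimes> y) \<otimes> (a \<otimes> b))"
        using c ab p q by algebra
      also have "\<dots> \<in> Q"
        using c ab p q
        by (intro Q.a_closed Q.I_r_closed [OF p(1)] Q.I_l_closed [OF q(1)] Q.I_l_closed [OF ab(3)]) auto
      finally show False using S(3) [OF p(3) q(3)] QI(3) by auto
    qed
  qed
  then show ?thesis using QI by blast
qed

text \<open>The powers of \<open>a\<close> form a multiplicative set that misses the zero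
  ideal.\<close>

lemma (in cring) exists_primeideal_not_nilpotent:
  assumes a: "a \<in> carrier R" "\<not> nilpotent R a"
  shows "\<exists>Q. primeideal Q R \<and> a \<notin> Q"
proof -
  define S where "S = range (\<lambda>n::nat. a [^] n)"
  have aS: "a \<in> S" unfolding S_def by (rule range_eqI [of _ _ 1]) (use a in simp)
  have "\<exists>Q. primeideal Q R \<and> {\<zero>} \<subseteq> Q \<and> Q \<inter> S = {}"
  proof (rule exists_primeideal_avoiding [OF zeroideal])
    show "{\<zero>} \<inter> S = {}" using a by (auto simp: nilpotent_def S_def)
    show "S \<subseteq> carrier R" using a by (auto simp: S_def)
    show "\<one> \<in> S" unfolding S_def by (rule range_eqI [of _ _ 0]) simp
    show "x \<otimes> y \<in> S" if "x \<in> S" "y \<in> S" for x y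
      using that a(1) by (auto simp: S_def nat_pow_mult)
  qed
  then show ?thesis using aS by blast
qed

text \<open>The principal ideal of a nonunit is proper, that is, disjoint from the multiplicative
  set \<open>{\<one>}\<close>.\<close>

lemma (in cring) exists_primeideal_nonunit:
  assumes a: "a \<in> carrier R" "a \<notin> Units R"
  shows "\<exists>Q. primeideal Q R \<and> a \<in> Q"
proof -
  have "\<one> \<notin> PIdl a"
    using a m_comm unfolding cgenideal_def Units_def by force
  then have "\<exists>Q. primeideal Q R \<and> PIdl a \<subseteq> Q \<and> Q \<inter> {\<one>} = {}"
    by (intro exists_primeideal_avoiding cgenideal_ideal a) auto
  then show ?thesis using cgenideal_self [OF a(1)] by blast
qed

section \<open>Powers and finite sums modulo an ideal\<close>

lemma (in primeideal) pow_memD: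
  assumes "a \<in> carrier R" "a [^] (n::nat) \<in> I"
  shows "a \<in> I"
  using assms(2)
proof (induction n)
  case 0
  then show ?case using I_notcarr one_imp_carrier by simp
next
  case (Suc n)
  then show ?case using I_prime [of "a [^] n" a] assms(1) by auto
qed

lemma (in primeideal) nilpotent_mem:
  assumes "nilpotent R a"
  shows "a \<in> I"
  using assms pow_memD additive_subgroup.zero_closed [OF is_additive_subgroup]
  unfolding nilpotent_def by metis

lemma (in ideal) finsum_mem:
  assumes "\<And>x. x \<in> A \<Longrightarrow> h x \<in> I"
  shows "finsum R h A \<in> I"
  using assms
\<comment> \<open>For infinite \<open>A\<close> the sum is \<open>\<zero>\<close> by convention,
  which lies in \<open>I\<close>.\<close>
proof (induction A rule: infinite_finite_induct)
  case (insert x F)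
  have "h \<in> F \<rightarrow> carrier R" "h x \<in> carrier R" using insert.prems Icarr by auto
  then show ?case using insert by simp
qed simp_all

text \<open>The term is the whole sum minus the remaining terms. This isolates the one summand that
  is not yet known to vanish modulo the ideal.\<close>

lemma (in ideal) mem_of_finsum_mem:
  assumes A: "finite A" "a \<in> A" and h: "h \<in> A \<rightarrow> carrier R"
    and others: "\<And>x. x \<in> A \<Longrightarrow> x \<noteq> a \<Longrightarrow> h x \<in> I" and sum: "finsum R h A \<in> I"
  shows "h a \<in> I"
proof -
  have rest: "finsum R h (A - {a}) \<in> I" using others by (intro finsum_mem) auto
  have a: "h a \<in> carrier R" using h A(2) by auto
  have "finsum R h (insert a (A - {a})) = h a \<oplus> finsum R h (A - {a})"
    using A h a by (intro finsum_insert) auto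
  then have "finsum R h A = h a \<oplus> finsum R h (A - {a})"
    using A(2) by (simp add: insert_absorb)
  then have "h a = finsum R h A \<ominus> finsum R h (A - {a})"
    using a Icarr [OF rest] by algebra
  then show ?thesis using sum rest by (simp add: minus_eq)
qed

section \<open>Homogeneous components\<close>

text \<open>The description is meaningful for \<open>x\<close> in \<open>carrier R\<close>, by
  \<open>direct_sum\<close>. The resulting family is extensional, so only its values on
  \<open>carrier G\<close> carry information.\<close>

definition homog_comp ::
  "('g, 'a) monoid_scheme \<Rightarrow> ('r, 'b) ring_scheme \<Rightarrow> ('g \<Rightarrow> 'r set) \<Rightarrow> 'r \<Rightarrow> 'g \<Rightarrow> 'r" where
  "homog_comp G R \<A> x =
     (THE c. c \<in> (\<Pi>\<^sub>E k\<in>carrier G. \<A> k) \<and> finite (deg_support G R c) \<and> x = deg_sum G R c)"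

context graded_ring
begin

abbreviation comp where "comp \<equiv> homog_comp G R \<A>"

lemma component_carrier: "k \<in> carrier G \<Longrightarrow> x \<in> \<A> k \<Longrightarrow> x \<in> carrier R"
  using additive_subgroup.a_subset [OF component_subgroup] by blast

lemma component_zero: "k \<in> carrier G \<Longrightarrow> \<zero> \<in> \<A> k"
  using additive_subgroup.zero_closed [OF component_subgroup] .

text \<open>Extra degrees contribute only zeros, so families with different supports can be summed
  over a common finite set.\<close>

lemma deg_sum_eq_finsum:
  assumes "finite S" "S \<subseteq> carrier G" "deg_support G R c \<subseteq> S"
    and "\<And>k. k \<in> carrier G \<Longrightarrow> c k \<in> carrier R"
  shows "deg_sum G R c = finsum R c S"
  unfolding deg_sum_def
  by (rule add.finprod_mono_neutral_cong_left)
    (use assms in \<open>auto simp: deg_support_def\<close>)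

lemma homog_comp_props:
  assumes "x \<in> carrier R"
  shows "comp x \<in> (\<Pi>\<^sub>E k\<in>carrier G. \<A> k)" "finite (deg_support G R (comp x))"
    "x = deg_sum G R (comp x)"
  using theI' [OF direct_sum [OF assms]] unfolding homog_comp_def by blast+

lemma homog_comp_mem: "x \<in> carrier R \<Longrightarrow> k \<in> carrier G \<Longrightarrow> comp x k \<in> \<A> k"
  by (rule PiE_mem [OF homog_comp_props(1)])

text \<open>Uniqueness in \<open>direct_sum\<close> applies to the restriction of \<open>c\<close>
  to \<open>carrier G\<close>, which has the same support and sum.\<close>

lemma homog_comp_eqI:
  assumes c: "\<And>k. k \<in> carrier G \<Longrightarrow> c k \<in> \<A> k" and fin: "finite (deg_support G R c)"
    and x: "x = deg_sum G R c" and k: "k \<in> carrier G"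
  shows "comp x k = c k"
proof -
  have cR: "c k \<in> carrier R" if "k \<in> carrier G" for k using c component_carrier that by blast
  let ?c = "restrict c (carrier G)"
  have supp: "deg_support G R ?c = deg_support G R c" by (auto simp: deg_support_def)
  have "deg_sum G R ?c = deg_sum G R c"
    unfolding deg_sum_def supp
    by (rule finsum_cong') (use cR in \<open>auto simp: deg_support_def\<close>)
  moreover have "?c \<in> (\<Pi>\<^sub>E k\<in>carrier G. \<A> k)" using c by auto
  moreover have "x \<in> carrier R"
    unfolding x deg_sum_def by (rule finsum_closed) (use cR in \<open>auto simp: deg_support_def\<close>)
  ultimately have "comp x = ?c"
    using homog_comp_props [OF \<open>x \<in> carrier R\<close>] direct_sum [OF \<open>x \<in> carrier R\<close>] fin supp x
    by metis
  then show ?thesis using k by simp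
qed

lemma homog_comp_homogeneous:
  assumes "k \<in> carrier G" "x \<in> \<A> k" "d \<in> carrier G"
  shows "comp x d = (if d = k then x else \<zero>)"
proof -
  let ?c = "\<lambda>d. if d = k then x else \<zero>"
  have x: "x \<in> carrier R" using assms component_carrier by blast
  have supp: "deg_support G R ?c \<subseteq> {k}" by (auto simp: deg_support_def)
  have "deg_sum G R ?c = finsum R ?c {k}"
    by (rule deg_sum_eq_finsum) (use assms supp x in auto)
  then have "deg_sum G R ?c = x" using x by simp
  then show ?thesis
    using homog_comp_eqI [of ?c x d] assms component_zero finite_subset [OF supp] by auto
qed

lemma homog_comp_add:
  assumes x: "x \<in> carrier R" and y: "y \<in> carrier R" and k: "k \<in> carrier G"
  shows "comp (x \<oplus> y) k = comp x k \<oplus> comp y k"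
proof -
  \<comment> \<open>The support of the sum may be smaller than this union, because terms can
    cancel.\<close>
  let ?S = "deg_support G R (comp x) \<union> deg_support G R (comp y)"
  let ?c = "\<lambda>k. comp x k \<oplus> comp y k"
  have S: "finite ?S" "?S \<subseteq> carrier G"
    using homog_comp_props x y by (auto simp: deg_support_def)
  have cR: "comp x k \<in> carrier R" "comp y k \<in> carrier R" if "k \<in> carrier G" for k
    using that x y homog_comp_mem component_carrier by blast+
  have supp: "deg_support G R ?c \<subseteq> ?S" by (auto simp: deg_support_def)
  have "x = finsum R (comp x) ?S" "y = finsum R (comp y) ?S"
    using homog_comp_props(3) [OF x] homog_comp_props(3) [OF y]
      deg_sum_eq_finsum [OF S, of "comp x"] deg_sum_eq_finsum [OF S, of "comp y"] cR
    by auto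
  moreover have "finsum R ?c ?S = finsum R (comp x) ?S \<oplus> finsum R (comp y) ?S"
    by (rule finsum_addf) (use S cR in auto)
  moreover have "deg_sum G R ?c = finsum R ?c ?S"
    by (rule deg_sum_eq_finsum [OF S supp]) (use cR in auto)
  ultimately have eq: "x \<oplus> y = deg_sum G R ?c" by simp
  have "?c k \<in> \<A> k" if "k \<in> carrier G" for k
    using that homog_comp_mem x y additive_subgroup.a_closed [OF component_subgroup] by blast
  then show ?thesis
    using homog_comp_eqI [OF _ _ eq k] finite_subset [OF supp S(1)] by blast
qed

lemma homog_comp_finsum:
  assumes "finite A" "h \<in> A \<rightarrow> carrier R" "k \<in> carrier G"
  shows "comp (finsum R h A) k = (\<Oplus>i\<in>A. comp (h i) k)"
  using assms
proof (induction A rule: finite_induct)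
  case empty
  then show ?case using homog_comp_homogeneous [of k \<zero> k] component_zero by simp
next
  case (insert i F)
  have "comp (h j) k \<in> carrier R" if "j \<in> insert i F" for j
    using that insert.prems homog_comp_mem component_carrier by blast
  then show ?case using insert by (simp add: Pi_def homog_comp_add)
qed

text \<open>For homogeneous \<open>x\<close> of degree \<open>k\<close>, the component of
  \<open>\<one> \<otimes> x\<close> in the degree \<open>m + k\<close> is the product of
  \<open>comp \<one> m\<close> with \<open>x\<close>. It vanishes, since \<open>m + k\<close>
  differs from \<open>k\<close>. So \<open>comp \<one> m\<close> annihilates every homogeneous
  element, hence also \<open>\<one>\<close>.\<close>

lemma homog_comp_one:
  assumes m: "m \<in> carrier G" "m \<noteq> \<one>\<^bsub>G\<^esub>"
  shows "comp \<one> m = \<zero>"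
proof -
  \<comment> \<open>Inserting \<open>m\<close> makes the summand at \<open>m\<close> occur even if
    it is zero.\<close>
  let ?e = "comp \<one>" and ?S = "insert m (deg_support G R (comp \<one>))"
  have S: "finite ?S" "?S \<subseteq> carrier G"
    using homog_comp_props(2) [OF one_closed] m by (auto simp: deg_support_def)
  have eA: "?e k \<in> \<A> k" if "k \<in> carrier G" for k using that homog_comp_mem by blast
  have eR: "?e k \<in> carrier R" if "k \<in> carrier G" for k using that eA component_carrier by blast
  have one: "\<one> = finsum R ?e ?S"
    using homog_comp_props(3) [OF one_closed] deg_sum_eq_finsum [OF S, of ?e] eR by auto
  have ann: "?e m \<otimes> x = \<zero>" if k: "k \<in> carrier G" and x: "x \<in> \<A> k" for k x
  proof -
    have xR: "x \<in> carrier R" using k x component_carrier by blast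
    have mk: "m \<otimes>\<^bsub>G\<^esub> k \<in> carrier G" using m k by simp
    \<comment> \<open>By cancellation in \<open>G\<close>, only \<open>d = m\<close> puts a summand
      into the degree \<open>m + k\<close>.\<close>
    have comp_term: "comp (?e d \<otimes> x) (m \<otimes>\<^bsub>G\<^esub> k) = (if m = d then ?e d \<otimes> x else \<zero>)" if "d \<in> ?S" for d
    proof -
      have d: "d \<in> carrier G" using that S by blast
      have "comp (?e d \<otimes> x) (m \<otimes>\<^bsub>G\<^esub> k)
          = (if m \<otimes>\<^bsub>G\<^esub> k = d \<otimes>\<^bsub>G\<^esub> k then ?e d \<otimes> x else \<zero>)"
        by (rule homog_comp_homogeneous)
          (use d k m x eA component_mult in auto)
      then show ?thesis using m d k by simp
    qed
    have "x = finsum R ?e ?S \<otimes> x" using one xR by (metis l_one)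
    also have "\<dots> = (\<Oplus>d\<in>?S. ?e d \<otimes> x)"
      using S xR eR by (intro finsum_ldistr) auto
    finally have "comp x (m \<otimes>\<^bsub>G\<^esub> k) = comp (\<Oplus>d\<in>?S. ?e d \<otimes> x) (m \<otimes>\<^bsub>G\<^esub> k)" by simp
    also have "\<dots> = (\<Oplus>d\<in>?S. comp (?e d \<otimes> x) (m \<otimes>\<^bsub>G\<^esub> k))"
      by (rule homog_comp_finsum) (use S xR eR mk in auto)
    also have "\<dots> = (\<Oplus>d\<in>?S. if m = d then ?e d \<otimes> x else \<zero>)"
      by (rule finsum_cong') (use comp_term S xR eR in auto)
    also have "\<dots> = ?e m \<otimes> x"
      by (rule finsum_singleton) (use S xR eR in auto)
    finally have "?e m \<otimes> x = comp x (m \<otimes>\<^bsub>G\<^esub> k)" by simp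
    also have "\<dots> = \<zero>"
      using homog_comp_homogeneous [OF k x mk] m k G.l_cancel_one by auto
    finally show ?thesis .
  qed
  have "?e m = ?e m \<otimes> finsum R ?e ?S" using one eR [OF m(1)] by (metis r_one)
  also have "\<dots> = (\<Oplus>d\<in>?S. ?e m \<otimes> ?e d)"
    using S eR m(1) by (intro finsum_rdistr) auto
  also have "\<dots> = \<zero>"
    by (rule add.finprod_one_eqI) (use ann eA S in blast)
  finally show ?thesis .
qed

section \<open>Units modulo a prime ideal\<close>

text \<open>Modulo \<open>Q\<close>, only the pair of minimal degrees contributes to the component
  of \<open>x \<otimes> y\<close> in degree \<open>a + b\<close>. If \<open>a + b\<close> were not
  the identity of \<open>G\<close>, this component of \<open>\<one>\<close> would be zero, so
  \<open>Q\<close> would contain a product of two elements outside of it.\<close>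

lemma unit_minimum_degrees_cancel:
  assumes Q: "primeideal Q R" and P: "total_cone G P"
    and fg: "x \<in> carrier R" "y \<in> carrier R" "x \<otimes> y = \<one>"
    and a: "a \<in> carrier G" "comp x a \<notin> Q"
    and b: "b \<in> carrier G" "comp y b \<notin> Q"
    and amin: "\<And>i. i \<in> carrier G \<Longrightarrow> comp x i \<notin> Q \<Longrightarrow> i \<otimes>\<^bsub>G\<^esub> inv\<^bsub>G\<^esub> a \<in> P"
    and bmin: "\<And>j. j \<in> carrier G \<Longrightarrow> comp y j \<notin> Q \<Longrightarrow> j \<otimes>\<^bsub>G\<^esub> inv\<^bsub>G\<^esub> b \<in> P"
  shows "a \<otimes>\<^bsub>G\<^esub> b = \<one>\<^bsub>G\<^esub>"
proof (rule ccontr)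
  interpret Q: primeideal Q R by (fact Q)
  let ?A = "deg_support G R (comp x)" and ?B = "deg_support G R (comp y)"
  let ?d = "a \<otimes>\<^bsub>G\<^esub> b"
  assume "?d \<noteq> \<one>\<^bsub>G\<^esub>"
  then have zero: "comp \<one> ?d = \<zero>" using homog_comp_one a b by simp
  have d: "?d \<in> carrier G" using a b by simp
  have A: "finite ?A" "?A \<subseteq> carrier G" and B: "finite ?B" "?B \<subseteq> carrier G"
    using homog_comp_props(2) fg by (auto simp: deg_support_def)
  have mem: "comp x i \<in> carrier R" "comp y i \<in> carrier R" if "i \<in> carrier G" for i
    using that homog_comp_mem component_carrier fg by blast+
  have aA: "a \<in> ?A" and bB: "b \<in> ?B"
    using a b by (auto simp: deg_support_def)
  let ?t = "\<lambda>i j. comp (comp x i \<otimes> comp y j) ?d"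
  have t: "?t i j = (if ?d = i \<otimes>\<^bsub>G\<^esub> j then comp x i \<otimes> comp y j else \<zero>)"
    if "i \<in> carrier G" "j \<in> carrier G" for i j
    by (rule homog_comp_homogeneous)
      (use that d fg homog_comp_mem component_mult in auto)
  have tR: "?t i j \<in> carrier R" if "i \<in> carrier G" "j \<in> carrier G" for i j
    using t [OF that] mem that by simp
  \<comment> \<open>If both factors lie outside of \<open>Q\<close>, minimality bounds
    \<open>i\<close> and \<open>j\<close> below by \<open>a\<close> and \<open>b\<close>, so no
    other pair has the degree \<open>?d\<close>. Otherwise the contribution is zero or has a factor
    in \<open>Q\<close>.\<close>
  have tQ: "?t i j \<in> Q" if ij: "i \<in> carrier G" "j \<in> carrier G" "i \<noteq> a \<or> j \<noteq> b" for i j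
  proof (cases "?d = i \<otimes>\<^bsub>G\<^esub> j \<and> comp x i \<notin> Q \<and> comp y j \<notin> Q")
    case True
    then show ?thesis
      using G.total_cone_unique_product [OF P a(1) b(1) ij(1,2)] amin bmin ij by metis
  next
    case False
    then show ?thesis
      using t [OF ij(1,2)] mem ij Q.I_l_closed Q.I_r_closed by auto
  qed
  have "x = finsum R (comp x) ?A" "y = finsum R (comp y) ?B"
    using homog_comp_props(3) fg unfolding deg_sum_def by auto
  then have "\<one> = finsum R (comp x) ?A \<otimes> y" using fg(3) by simp
  also have "\<dots> = (\<Oplus>i\<in>?A. comp x i \<otimes> y)"
    by (rule finsum_ldistr) (use A mem fg in auto)
  finally have "comp \<one> ?d = (\<Oplus>i\<in>?A. comp (comp x i \<otimes> y) ?d)"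
    using homog_comp_finsum [of ?A "\<lambda>i. comp x i \<otimes> y" ?d] A mem fg d by auto
  moreover have "comp (comp x i \<otimes> y) ?d = (\<Oplus>j\<in>?B. ?t i j)" if "i \<in> ?A" for i
  proof -
    have i: "i \<in> carrier G" using that A by auto
    have "comp x i \<otimes> y = comp x i \<otimes> finsum R (comp y) ?B"
      using \<open>y = finsum R (comp y) ?B\<close> by simp
    also have "\<dots> = (\<Oplus>j\<in>?B. comp x i \<otimes> comp y j)"
      by (rule finsum_rdistr) (use B i mem in auto)
    finally show ?thesis
      using homog_comp_finsum [of ?B "\<lambda>j. comp x i \<otimes> comp y j" ?d] B i mem d by auto
  qed
  moreover have sR: "(\<Oplus>j\<in>?B. ?t i j) \<in> carrier R" if "i \<in> ?A" for i
    by (rule finsum_closed) (use that A B tR in auto)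
  moreover have "(\<Oplus>i\<in>?A. comp (comp x i \<otimes> y) ?d) = (\<Oplus>i\<in>?A. \<Oplus>j\<in>?B. ?t i j)"
    by (rule finsum_cong') (use calculation in auto)
  ultimately have "comp \<one> ?d = (\<Oplus>i\<in>?A. \<Oplus>j\<in>?B. ?t i j)" by simp
  then have "(\<Oplus>i\<in>?A. \<Oplus>j\<in>?B. ?t i j) \<in> Q" using zero Q.zero_closed by metis
  \<comment> \<open>The double sum is reduced in two rounds: first to the row \<open>a\<close>, then
    within that row to the entry at \<open>b\<close>.\<close>
  moreover have "(\<Oplus>j\<in>?B. ?t i j) \<in> Q" if "i \<in> ?A" "i \<noteq> a" for i
    by (rule Q.finsum_mem) (use A B that in \<open>blast intro: tQ\<close>)
  ultimately have "(\<Oplus>j\<in>?B. ?t a j) \<in> Q"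
    using Q.mem_of_finsum_mem [OF A(1) aA, of "\<lambda>i. \<Oplus>j\<in>?B. ?t i j"] sR by blast
  then have "?t a b \<in> Q"
    by (rule Q.mem_of_finsum_mem [OF B(1) bB, rotated 2])
      (use a B tR in \<open>auto intro: tQ\<close>)
  then have "comp x a \<otimes> comp y b \<in> Q" using t [OF a(1) b(1)] by simp
  then show False using Q.I_prime [OF mem(1) [OF a(1)] mem(2) [OF b(1)]] a(2) b(2) by blast
qed

text \<open>Minima and maxima of the surviving degrees of \<open>x\<close> and \<open>y\<close> have
  the same product, the identity of \<open>G\<close>, which forces minimum and maximum to
  coincide.\<close>

lemma unit_degree_unique:
  assumes G: "torsion_free G" and Q: "primeideal Q R"
    and fg: "x \<in> carrier R" "y \<in> carrier R" "x \<otimes> y = \<one>"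
    and i: "i \<in> carrier G" "comp x i \<notin> Q" and k: "k \<in> carrier G" "comp x k \<notin> Q"
  shows "i = k"
proof -
  interpret Q: primeideal Q R by (fact Q)
  obtain P where P: "total_cone G P" using G.exists_total_cone [OF G] by blast
  let ?P' = "{x \<in> carrier G. inv\<^bsub>G\<^esub> x \<in> P}"
  have P': "total_cone G ?P'" using G.total_cone_opposite [OF P] .
  define A where "A = {i \<in> carrier G. comp x i \<notin> Q}"
  define B where "B = {j \<in> carrier G. comp y j \<notin> Q}"
  have "A \<subseteq> deg_support G R (comp x)" "B \<subseteq> deg_support G R (comp y)"
    by (auto simp: A_def B_def deg_support_def)
  then have fin: "finite A" "finite B"
    using homog_comp_props(2) fg finite_subset by blast+
  have sub: "A \<subseteq> carrier G" "B \<subseteq> carrier G" by (auto simp: A_def B_def)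
  have "A \<noteq> {}" using i by (auto simp: A_def)
  \<comment> \<open>Otherwise all components of \<open>y\<close> lie in \<open>Q\<close>, hence
    \<open>y\<close> and with it \<open>\<one>\<close>.\<close>
  have "B \<noteq> {}"
  proof
    assume "B = {}"
    then have "finsum R (comp y) (deg_support G R (comp y)) \<in> Q"
      by (intro Q.finsum_mem) (auto simp: B_def deg_support_def)
    then have "y \<in> Q" using homog_comp_props(3) [OF fg(2)] by (simp add: deg_sum_def)
    then have "\<one> \<in> Q" using Q.I_l_closed fg by metis
    then show False using Q.I_notcarr Q.one_imp_carrier by blast
  qed
  obtain a where a: "a \<in> A" "\<And>x. x \<in> A \<Longrightarrow> x \<otimes>\<^bsub>G\<^esub> inv\<^bsub>G\<^esub> a \<in> P"
    using G.total_cone_minimum [OF P fin(1) \<open>A \<noteq> {}\<close> sub(1)] by blast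
  obtain b where b: "b \<in> B" "\<And>x. x \<in> B \<Longrightarrow> x \<otimes>\<^bsub>G\<^esub> inv\<^bsub>G\<^esub> b \<in> P"
    using G.total_cone_minimum [OF P fin(2) \<open>B \<noteq> {}\<close> sub(2)] by blast
  obtain a' where a': "a' \<in> A" "\<And>x. x \<in> A \<Longrightarrow> x \<otimes>\<^bsub>G\<^esub> inv\<^bsub>G\<^esub> a' \<in> ?P'"
    using G.total_cone_minimum [OF P' fin(1) \<open>A \<noteq> {}\<close> sub(1)] by blast
  obtain b' where b': "b' \<in> B" "\<And>x. x \<in> B \<Longrightarrow> x \<otimes>\<^bsub>G\<^esub> inv\<^bsub>G\<^esub> b' \<in> ?P'"
    using G.total_cone_minimum [OF P' fin(2) \<open>B \<noteq> {}\<close> sub(2)] by blast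
  have "a \<otimes>\<^bsub>G\<^esub> b = \<one>\<^bsub>G\<^esub>"
    using a b unfolding A_def B_def by (intro unit_minimum_degrees_cancel [OF Q P fg]) blast+
  moreover have "a' \<otimes>\<^bsub>G\<^esub> b' = \<one>\<^bsub>G\<^esub>"
    using a' b' unfolding A_def B_def by (intro unit_minimum_degrees_cancel [OF Q P' fg]) blast+
  \<comment> \<open>The maxima \<open>a'\<close> and \<open>b'\<close> lie above the minima
    \<open>a\<close> and \<open>b\<close> and have the same product.\<close>
  ultimately have "a' = a"
    using G.total_cone_unique_product [OF P _ _ _ _ a(2) [OF a'(1)] b(2) [OF b'(1)]]
      a(1) a'(1) b(1) b'(1) sub by (simp add: subset_iff)
  \<comment> \<open>Each surviving degree is squeezed between the minimum \<open>a\<close> and the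
    maximum \<open>a' = a\<close>.\<close>
  have "c = a" if c: "c \<in> A" for c
  proof -
    have car: "c \<in> carrier G" "a \<in> carrier G" using c a sub by auto
    have "c \<otimes>\<^bsub>G\<^esub> inv\<^bsub>G\<^esub> a \<in> P" "inv\<^bsub>G\<^esub> (c \<otimes>\<^bsub>G\<^esub> inv\<^bsub>G\<^esub> a) \<in> P"
      using a(2) a'(2) c \<open>a' = a\<close> by auto
    then have "c \<otimes>\<^bsub>G\<^esub> inv\<^bsub>G\<^esub> a = \<one>\<^bsub>G\<^esub>"
      using P unfolding total_cone_def pointed_cone_def by blast
    then show ?thesis
      using G.inv_equality [of c "inv\<^bsub>G\<^esub> a"] car by simp
  qed
  then show ?thesis using i k by (auto simp: A_def)
qed

end

section \<open>The equivalence, tested on prime ideals\<close>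

theorem theorem5p8:
  fixes G :: "('g, 'a) monoid_scheme"
    and R :: "('r, 'b) ring_scheme"
    and \<A> :: "'g \<Rightarrow> 'r set"
    and r :: "'g \<Rightarrow> 'r"
    and f :: 'r
  assumes "comm_group G"
    and "torsion_free G"
    and "cring R"
    and "graded_ring R G \<A>"
    and "\<And>k. k \<in> carrier G \<Longrightarrow> r k \<in> \<A> k"
    and "finite (deg_support G R r)"
    and "f = deg_sum G R r"
  shows "f \<in> Units R \<longleftrightarrow>
    genideal R (r ` carrier G) = carrier R \<and>
    (\<forall>i\<in>carrier G. \<forall>k\<in>carrier G. i \<noteq> k \<longrightarrow> nilpotent R (r i \<otimes>\<^bsub>R\<^esub> r k))"
proof -
  interpret cring R by (fact assms(3))
  interpret graded_ring R G \<A> by (fact assms(4))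
  let ?S = "deg_support G R r"
  have rR: "r k \<in> carrier R" if "k \<in> carrier G" for k
    using that assms(5) component_carrier by blast
  have S: "?S \<subseteq> carrier G" by (auto simp: deg_support_def)
  have f: "f = finsum R r ?S" using assms(7) by (simp add: deg_sum_def)
  have fR: "f \<in> carrier R" unfolding f by (rule finsum_closed) (use rR S in auto)
  \<comment> \<open>The given decomposition is the canonical one, so results about
    \<open>comp f\<close> apply to \<open>r\<close>.\<close>
  have comp: "comp f k = r k" if "k \<in> carrier G" for k
    using homog_comp_eqI [OF assms(5,6,7) that] .
  have gen: "r ` carrier G \<subseteq> carrier R" using rR by auto
  show ?thesis
  proof (intro iffI conjI ballI impI)
    assume "f \<in> Units R"
    then obtain g where g: "g \<in> carrier R" "f \<otimes>\<^bsub>R\<^esub> g = \<one>\<^bsub>R\<^esub>" by (auto simp: Units_def)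
    interpret I: ideal "genideal R (r ` carrier G)" R by (rule genideal_ideal [OF gen])
    have "f \<in> genideal R (r ` carrier G)"
      unfolding f by (rule I.finsum_mem) (use S genideal_self [OF gen] in auto)
    then have "\<one>\<^bsub>R\<^esub> \<in> genideal R (r ` carrier G)" using I.I_r_closed g by metis
    then show "genideal R (r ` carrier G) = carrier R" by (rule I.one_imp_carrier)
    fix i k assume ik: "i \<in> carrier G" "k \<in> carrier G" "i \<noteq> k"
    show "nilpotent R (r i \<otimes>\<^bsub>R\<^esub> r k)"
    proof (rule ccontr)
      assume "\<not> ?thesis"
      then obtain Q where Q: "primeideal Q R" "r i \<otimes>\<^bsub>R\<^esub> r k \<notin> Q"
        using exists_primeideal_not_nilpotent rR ik by (meson m_closed)
      interpret Q: primeideal Q R by (fact Q(1))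
      have "r i \<notin> Q" "r k \<notin> Q" using Q(2) Q.I_l_closed Q.I_r_closed rR ik by blast+
      then show False
        using unit_degree_unique [OF assms(2) Q(1) fR g] comp ik by metis
    qed
  next
    assume *: "genideal R (r ` carrier G) = carrier R \<and>
      (\<forall>i\<in>carrier G. \<forall>k\<in>carrier G. i \<noteq> k \<longrightarrow> nilpotent R (r i \<otimes>\<^bsub>R\<^esub> r k))"
    show "f \<in> Units R"
    proof (rule ccontr)
      assume "f \<notin> Units R"
      then obtain Q where Q: "primeideal Q R" "f \<in> Q"
        using exists_primeideal_nonunit fR by blast
      interpret Q: primeideal Q R by (fact Q(1))
      \<comment> \<open>If \<open>r k\<close> were outside of \<open>Q\<close>, nilpotency of the
        products would force every other \<open>r i\<close> into \<open>Q\<close>. Then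
        \<open>r k\<close> is the only remaining term of the sum \<open>f\<close>, which lies in
        \<open>Q\<close>, so \<open>r k\<close> does too.\<close>
      have "r k \<in> Q" if k: "k \<in> carrier G" for k
      proof (rule ccontr)
        assume nk: "r k \<notin> Q"
        have "r i \<in> Q" if "i \<in> carrier G" "i \<noteq> k" for i
          using * that k nk Q.nilpotent_mem Q.I_prime rR by metis
        moreover have "k \<in> ?S" using nk k by (auto simp: deg_support_def)
        ultimately have "r k \<in> Q"
          using Q.mem_of_finsum_mem [OF assms(6), of k r] Q(2) f S rR by auto
        then show False using nk by simp
      qed
      then have "genideal R (r ` carrier G) \<subseteq> Q"
        by (intro genideal_minimal Q.is_ideal) auto
      then show False using * Q.I_notcarr Q.a_subset by auto
    qed
  qed
qed

end
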